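(* Let $R$ be a ring, let $M$ be a Euclidean $R$-module and let $a_1,\ldots,a_n\in M$. Then for an element $g\in M$ the following statements are equivalent: (1) $g=\gcd(a_1,\ldots,a_n)$, i.e. $g$ is a greatest common divisor of $a_1,\ldots,a_n$. (2) For each $i=1,\ldots,n$, $a_i=r_ig$ for some $r_i\in R$, and if an element $g'\in M$ satisfies the same condition (i.e. $a_i=r_i'g'$ for some $r_i'\in R$, for each $i$) then $g=\alpha g'$ for some $\alpha\in R$. (3) For each $i=1,\ldots,n$, $a_i=r_ig$ for some $r_i\in R$, and $g=\sum_{i=1}^n s_ia_i$ for some $s_i\in R$. In particular, $\gcd(a_1,\ldots,a_n)=\sum_{i=1}^n s_ia_i$ for some elements $s_i\in R$.
   Context: Rings are unital and modules are left modules. A poset is Artinian if every descending chain in it stabilizes. An $R$-module $M$ is a Euclidean module if there is a function $d_M:M\setminus\{0\}\to P$ to a poset $(P,\ge)$ such that the poset $\mathrm{im}(d_M)$ is Artinian and, for any nonzero $u,v\in M$, there are $q\in R$ and $r\in M$ with $u=qv+r$ and either $r=0$ or $d_M(r)<d_M(v)$. Every submodule of a Euclidean module is cyclic. A greatest common divisor $\gcd(a_1,\ldots,a_n)$ of $a_1,\ldots,a_n\in M$ is any generator of the cyclic submodule $\sum_{i=1}^nRa_i$; it is in general not unique, and "$g=\gcd(a_1,\ldots,a_n)$" means that $g$ is such a generator. *)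

theory Defs
  imports "HOL-Algebra.Module"
begin

text \<open>The locale \<open>module\<close> of the library requires a commutative ring of scalars. Left modules
  over an arbitrary unital ring have the same axioms otherwise.\<close>

locale left_module = R?: ring R + M?: abelian_group M for R (structure) and M (structure) +
  assumes smult_closed:
      "\<lbrakk>r \<in> carrier R; x \<in> carrier M\<rbrakk> \<Longrightarrow> r \<odot>\<^bsub>M\<^esub> x \<in> carrier M"
    and smult_l_distr:
      "\<lbrakk>r \<in> carrier R; s \<in> carrier R; x \<in> carrier M\<rbrakk> \<Longrightarrow>
       (r \<oplus>\<^bsub>R\<^esub> s) \<odot>\<^bsub>M\<^esub> x = r \<odot>\<^bsub>M\<^esub> x \<oplus>\<^bsub>M\<^esub> s \<odot>\<^bsub>M\<^esub> x"
    and smult_r_distr: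
      "\<lbrakk>r \<in> carrier R; x \<in> carrier M; y \<in> carrier M\<rbrakk> \<Longrightarrow>
       r \<odot>\<^bsub>M\<^esub> (x \<oplus>\<^bsub>M\<^esub> y) = r \<odot>\<^bsub>M\<^esub> x \<oplus>\<^bsub>M\<^esub> r \<odot>\<^bsub>M\<^esub> y"
    and smult_assoc:
      "\<lbrakk>r \<in> carrier R; s \<in> carrier R; x \<in> carrier M\<rbrakk> \<Longrightarrow>
       (r \<otimes>\<^bsub>R\<^esub> s) \<odot>\<^bsub>M\<^esub> x = r \<odot>\<^bsub>M\<^esub> (s \<odot>\<^bsub>M\<^esub> x)"
    and smult_one:
      "x \<in> carrier M \<Longrightarrow> \<one>\<^bsub>R\<^esub> \<odot>\<^bsub>M\<^esub> x = x"

definition artinian_poset :: "('p, 'k) gorder_scheme \<Rightarrow> bool" where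
  "artinian_poset P \<longleftrightarrow> partial_order P \<and>
     (\<forall>c :: nat \<Rightarrow> 'p. (\<forall>k. c k \<in> carrier P \<and> c (Suc k) \<sqsubseteq>\<^bsub>P\<^esub> c k) \<longrightarrow>
        (\<exists>N. \<forall>k\<ge>N. c k = c N))"

definition euclidean_function ::
  "('a, 'k) ring_scheme \<Rightarrow> ('a, 'b, 'l) module_scheme \<Rightarrow> 'p gorder \<Rightarrow> ('b \<Rightarrow> 'p) \<Rightarrow> bool" where
  "euclidean_function R M P d \<longleftrightarrow>
     partial_order P \<and>
     d \<in> carrier M - {\<zero>\<^bsub>M\<^esub>} \<rightarrow> carrier P \<and>
     artinian_poset (P\<lparr>carrier := d ` (carrier M - {\<zero>\<^bsub>M\<^esub>})\<rparr>) \<and>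
     (\<forall>u \<in> carrier M - {\<zero>\<^bsub>M\<^esub>}. \<forall>v \<in> carrier M - {\<zero>\<^bsub>M\<^esub>}.
        \<exists>q \<in> carrier R. \<exists>r \<in> carrier M.
          u = q \<odot>\<^bsub>M\<^esub> v \<oplus>\<^bsub>M\<^esub> r \<and> (r = \<zero>\<^bsub>M\<^esub> \<or> d r \<sqsubset>\<^bsub>P\<^esub> d v))"

text \<open>The poset in which the Euclidean function takes its values is arbitrary. As types cannot be
  quantified over, the type of its elements is a parameter; a theorem assuming
  \<open>euclidean_module TYPE('p) R M\<close> with a free type variable \<open>'p\<close> holds for every choice of it.\<close>

definition euclidean_module ::
  "'p itself \<Rightarrow> ('a, 'k) ring_scheme \<Rightarrow> ('a, 'b, 'l) module_scheme \<Rightarrow> bool" where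
  "euclidean_module (T :: 'p itself) R M \<longleftrightarrow>
     left_module R M \<and> (\<exists>(P :: 'p gorder) d. euclidean_function R M P d)"

definition cyclic_submodule ::
  "('a, 'k) ring_scheme \<Rightarrow> ('a, 'b, 'l) module_scheme \<Rightarrow> 'b \<Rightarrow> 'b set" where
  "cyclic_submodule R M x = {r \<odot>\<^bsub>M\<^esub> x | r. r \<in> carrier R}"

text \<open>The sum of a family of submodules indexed by a finite set.\<close>

definition submodule_sum ::
  "('a, 'b, 'l) module_scheme \<Rightarrow> 'i set \<Rightarrow> ('i \<Rightarrow> 'b set) \<Rightarrow> 'b set" where
  "submodule_sum M I N = {(\<Oplus>\<^bsub>M\<^esub>i\<in>I. x i) | x. x \<in> Pi I N}"

text \<open>Greatest common divisors are not unique, hence a predicate: \<open>g\<close> is a gcd of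
  \<open>a 1, \<dots>, a n\<close>.\<close>

definition is_gcd ::
  "('a, 'k) ring_scheme \<Rightarrow> ('a, 'b, 'l) module_scheme \<Rightarrow> nat \<Rightarrow> (nat \<Rightarrow> 'b) \<Rightarrow> 'b \<Rightarrow> bool" where
  "is_gcd R M n a g \<longleftrightarrow> g \<in> carrier M \<and>
     cyclic_submodule R M g = submodule_sum M {1..n} (\<lambda>i. cyclic_submodule R M (a i))"

end

theory Submission
  imports Defs
begin

text \<open>Since the Euclidean function takes its values in an Artinian poset, every nonzero submodule
  contains a nonzero element of minimal value, and division with remainder shows that it generates the
  submodule. Hence the submodule \<open>N\<close> generated by \<open>a\<^sub>1, \<dots>, a\<^sub>n\<close>
  is \<open>R h\<close> for some \<open>h\<close>. An element \<open>g\<close> divides all \<open>a\<^sub>i\<close> iff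
  \<open>N \<subseteq> R g\<close>, and it is a combination of the \<open>a\<^sub>i\<close> iff
  \<open>g \<in> N\<close>; minimality of \<open>g\<close> among common divisors, applied to
  \<open>h\<close>, gives \<open>g \<in> R h = N\<close>.\<close>

section \<open>Minimal elements in Artinian posets\<close>

text \<open>A strictly descending infinite chain could not stabilize, so the strict order is
  well-founded on the carrier, and well-foundedness provides minimal elements.\<close>

lemma artinian_poset_minimal:
  assumes "artinian_poset P" "A \<subseteq> carrier P" "A \<noteq> {}"
  obtains m where "m \<in> A" "\<And>x. x \<in> A \<Longrightarrow> \<not> x \<sqsubset>\<^bsub>P\<^esub> m"
proof -
  interpret partial_order P
    using assms(1) by (simp add: artinian_poset_def)
  \<comment> \<open>The chain condition only speaks of chains in the carrier, so the strict order is
    restricted to the carrier.\<close>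
  define r where "r = {(x, y). x \<in> carrier P \<and> y \<in> carrier P \<and> x \<sqsubset>\<^bsub>P\<^esub> y}"
  have "wf r"
    unfolding wf_iff_no_infinite_down_chain
  proof (rule notI, elim exE)
    fix c :: "nat \<Rightarrow> _"
    assume "\<forall>i. (c (Suc i), c i) \<in> r"
    then have c: "c i \<in> carrier P" "c (Suc i) \<sqsubset>\<^bsub>P\<^esub> c i" for i
      by (auto simp: r_def)
    then have "\<exists>N. \<forall>k\<ge>N. c k = c N"
      using assms(1) unfolding artinian_poset_def by (blast intro: lless_imp_le)
    then obtain N where "c (Suc N) = c N"
      using le_SucI by blast
    then show False
      using c[of N] by (simp add: lless_def)
  qed
  then obtain m where m: "m \<in> A" "\<And>x. (x, m) \<in> r \<Longrightarrow> x \<notin> A"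
    using assms(3) wfE_min'[of r A] by metis
  have "\<not> x \<sqsubset>\<^bsub>P\<^esub> m" if "x \<in> A" for x
    using m that assms(2) unfolding r_def by blast
  with m(1) show thesis
    by (rule that)
qed

context left_module
begin

section \<open>Arithmetic in left modules\<close>

lemma smult_l_null:
  assumes "x \<in> carrier M"
  shows "\<zero>\<^bsub>R\<^esub> \<odot>\<^bsub>M\<^esub> x = \<zero>\<^bsub>M\<^esub>"
  using smult_l_distr[of "\<zero>\<^bsub>R\<^esub>" "\<zero>\<^bsub>R\<^esub>" x] smult_closed[of "\<zero>\<^bsub>R\<^esub>" x] assms
  by (simp add: M.add.r_cancel_one')

lemma smult_r_null:
  assumes "r \<in> carrier R"
  shows "r \<odot>\<^bsub>M\<^esub> \<zero>\<^bsub>M\<^esub> = \<zero>\<^bsub>M\<^esub>"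
  using smult_r_distr[of r "\<zero>\<^bsub>M\<^esub>" "\<zero>\<^bsub>M\<^esub>"] smult_closed[of r "\<zero>\<^bsub>M\<^esub>"] assms
  by (simp add: M.add.r_cancel_one')

lemma smult_l_minus:
  assumes "r \<in> carrier R" "x \<in> carrier M"
  shows "(\<ominus>\<^bsub>R\<^esub> r) \<odot>\<^bsub>M\<^esub> x = \<ominus>\<^bsub>M\<^esub> (r \<odot>\<^bsub>M\<^esub> x)"
proof -
  have "(\<ominus>\<^bsub>R\<^esub> r) \<odot>\<^bsub>M\<^esub> x \<oplus>\<^bsub>M\<^esub> r \<odot>\<^bsub>M\<^esub> x = \<zero>\<^bsub>M\<^esub>"
    using smult_l_distr[of "\<ominus>\<^bsub>R\<^esub> r" r x] assms by (simp add: R.l_neg smult_l_null)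
  then show ?thesis
    using assms by (simp add: M.minus_equality smult_closed)
qed

section \<open>Submodules and cyclic submodules\<close>

text \<open>The locale \<open>submodule\<close> extends subgroups of the additive group and so asks
  for closure under negation. This follows from closure under scalars, as negation is multiplication
  by -1.\<close>

lemma submoduleI:
  assumes "H \<subseteq> carrier M" "\<zero>\<^bsub>M\<^esub> \<in> H"
    and "\<And>x y. \<lbrakk>x \<in> H; y \<in> H\<rbrakk> \<Longrightarrow> x \<oplus>\<^bsub>M\<^esub> y \<in> H"
    and smult: "\<And>r x. \<lbrakk>r \<in> carrier R; x \<in> H\<rbrakk> \<Longrightarrow> r \<odot>\<^bsub>M\<^esub> x \<in> H"
  shows "submodule H R M"
proof -
  have "\<ominus>\<^bsub>M\<^esub> x \<in> H" if "x \<in> H" for x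
    using smult[of "\<ominus>\<^bsub>R\<^esub> \<one>\<^bsub>R\<^esub>" x] that assms(1) by (auto simp: smult_l_minus smult_one)
  then show ?thesis
    using assms by unfold_locales (auto simp: a_inv_def)
qed

lemma submoduleD:
  assumes "submodule H R M"
  shows "H \<subseteq> carrier M" "\<zero>\<^bsub>M\<^esub> \<in> H"
    and "\<lbrakk>x \<in> H; y \<in> H\<rbrakk> \<Longrightarrow> x \<oplus>\<^bsub>M\<^esub> y \<in> H"
    and "\<lbrakk>r \<in> carrier R; x \<in> H\<rbrakk> \<Longrightarrow> r \<odot>\<^bsub>M\<^esub> x \<in> H"
proof -
  interpret H: submodule H R M by fact
  show "H \<subseteq> carrier M" "\<zero>\<^bsub>M\<^esub> \<in> H"
    and "\<lbrakk>x \<in> H; y \<in> H\<rbrakk> \<Longrightarrow> x \<oplus>\<^bsub>M\<^esub> y \<in> H"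
    and "\<lbrakk>r \<in> carrier R; x \<in> H\<rbrakk> \<Longrightarrow> r \<odot>\<^bsub>M\<^esub> x \<in> H"
    using H.subset H.one_closed H.m_closed[of x y] H.smult_closed[of r x] by auto
qed

lemma cyclic_submodule_submodule:
  assumes "x \<in> carrier M"
  shows "submodule (cyclic_submodule R M x) R M"
proof (rule submoduleI)
  show "cyclic_submodule R M x \<subseteq> carrier M"
    using assms by (auto simp: cyclic_submodule_def smult_closed)
  show "\<zero>\<^bsub>M\<^esub> \<in> cyclic_submodule R M x"
    using smult_l_null[OF assms] unfolding cyclic_submodule_def by force
  show "y \<oplus>\<^bsub>M\<^esub> z \<in> cyclic_submodule R M x"
    if "y \<in> cyclic_submodule R M x" "z \<in> cyclic_submodule R M x" for y z
    using that assms unfolding cyclic_submodule_def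
    by (auto simp: smult_l_distr[symmetric])
  show "r \<odot>\<^bsub>M\<^esub> y \<in> cyclic_submodule R M x"
    if "r \<in> carrier R" "y \<in> cyclic_submodule R M x" for r y
    using that assms unfolding cyclic_submodule_def
    by (auto simp: smult_assoc[symmetric])
qed

lemma generator_in_cyclic_submodule:
  assumes "x \<in> carrier M"
  shows "x \<in> cyclic_submodule R M x"
  using smult_one[OF assms] unfolding cyclic_submodule_def
  by (auto intro!: exI[of _ "\<one>\<^bsub>R\<^esub>"])

lemma cyclic_submodule_least:
  assumes "submodule H R M" "x \<in> H"
  shows "cyclic_submodule R M x \<subseteq> H"
  using submoduleD(4)[OF assms(1)] assms(2) by (auto simp: cyclic_submodule_def)

section \<open>Sums of elements and of submodules\<close>

lemma submodule_finsum_closed: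
  assumes H: "submodule H R M" and "x \<in> I \<rightarrow> H"
  shows "(\<Oplus>\<^bsub>M\<^esub>i\<in>I. x i) \<in> H"
  using assms(2)
proof (induction I rule: infinite_finite_induct)
  case (insert i I)
  then have "x \<in> I \<rightarrow> carrier M" "x i \<in> carrier M"
    using submoduleD(1)[OF H] by auto
  then show ?case
    using insert submoduleD(3)[OF H] by (auto simp: M.finsum_insert)
\<comment> \<open>For infinite \<open>I\<close> the sum has the default value zero, which lies in
  \<open>H\<close>, just like the empty sum.\<close>
qed (use submoduleD(2)[OF H] in auto)

lemma finsum_smult:
  assumes "r \<in> carrier R" "x \<in> I \<rightarrow> carrier M"
  shows "r \<odot>\<^bsub>M\<^esub> (\<Oplus>\<^bsub>M\<^esub>i\<in>I. x i) = (\<Oplus>\<^bsub>M\<^esub>i\<in>I. r \<odot>\<^bsub>M\<^esub> x i)"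
  using assms(2)
proof (induction I rule: infinite_finite_induct)
  case (insert i I)
  then have "x \<in> I \<rightarrow> carrier M" "x i \<in> carrier M" "(\<lambda>i. r \<odot>\<^bsub>M\<^esub> x i) \<in> I \<rightarrow> carrier M"
    using assms(1) by (auto intro!: smult_closed)
  then show ?case
    using insert assms(1) by (simp add: M.finsum_insert smult_r_distr smult_closed)
qed (use assms(1) in \<open>auto simp: smult_r_null\<close>)

lemma submodule_sum_submodule:
  assumes N: "\<And>i. i \<in> I \<Longrightarrow> submodule (N i) R M"
  shows "submodule (submodule_sum M I N) R M"
proof (rule submoduleI)
  have car: "x \<in> I \<rightarrow> carrier M" if "x \<in> Pi I N" for x
    using that submoduleD(1)[OF N] by blast
  show "submodule_sum M I N \<subseteq> carrier M"
    using car by (auto simp: submodule_sum_def)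
  have "(\<lambda>i. \<zero>\<^bsub>M\<^esub>) \<in> Pi I N"
    using submoduleD(2)[OF N] by simp
  moreover have "\<zero>\<^bsub>M\<^esub> = (\<Oplus>\<^bsub>M\<^esub>i\<in>I. \<zero>\<^bsub>M\<^esub>)"
    by simp
  ultimately show "\<zero>\<^bsub>M\<^esub> \<in> submodule_sum M I N"
    unfolding submodule_sum_def by blast
  show "y \<oplus>\<^bsub>M\<^esub> z \<in> submodule_sum M I N"
    if yz: "y \<in> submodule_sum M I N" "z \<in> submodule_sum M I N" for y z
  proof -
    obtain u v where "u \<in> Pi I N" "v \<in> Pi I N"
      and eq: "y = (\<Oplus>\<^bsub>M\<^esub>i\<in>I. u i)" "z = (\<Oplus>\<^bsub>M\<^esub>i\<in>I. v i)"
      using yz unfolding submodule_sum_def by blast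
    moreover have "(\<lambda>i. u i \<oplus>\<^bsub>M\<^esub> v i) \<in> Pi I N"
      using calculation submoduleD(3)[OF N] by blast
    moreover have "y \<oplus>\<^bsub>M\<^esub> z = (\<Oplus>\<^bsub>M\<^esub>i\<in>I. u i \<oplus>\<^bsub>M\<^esub> v i)"
      using calculation car by (simp add: M.finsum_addf)
    ultimately show ?thesis
      unfolding submodule_sum_def by blast
  qed
  show "r \<odot>\<^bsub>M\<^esub> y \<in> submodule_sum M I N"
    if r: "r \<in> carrier R" and y: "y \<in> submodule_sum M I N" for r y
  proof -
    obtain u where u: "u \<in> Pi I N" and eq: "y = (\<Oplus>\<^bsub>M\<^esub>i\<in>I. u i)"
      using y unfolding submodule_sum_def by blast
    have "(\<lambda>i. r \<odot>\<^bsub>M\<^esub> u i) \<in> Pi I N"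
      using u r submoduleD(4)[OF N] by blast
    moreover have "r \<odot>\<^bsub>M\<^esub> y = (\<Oplus>\<^bsub>M\<^esub>i\<in>I. r \<odot>\<^bsub>M\<^esub> u i)"
      using u r car eq by (simp add: finsum_smult)
    ultimately show ?thesis
      unfolding submodule_sum_def by blast
  qed
qed

text \<open>Together with \<open>submodule_sum_least\<close> this makes the sum the least submodule
  containing every \<open>N i\<close>.\<close>

lemma submodule_sum_upper:
  assumes "finite I" "i \<in> I" and N: "\<And>j. j \<in> I \<Longrightarrow> submodule (N j) R M"
  shows "N i \<subseteq> submodule_sum M I N"
proof
  fix y
  assume y: "y \<in> N i"
  then have "y \<in> carrier M"
    using submoduleD(1)[OF N[OF assms(2)]] by blast
  \<comment> \<open>The witness is the family concentrated at \<open>i\<close>: it is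
    \<open>y\<close> there and zero elsewhere.\<close>
  then have "y = (\<Oplus>\<^bsub>M\<^esub>j\<in>I. if i = j then y else \<zero>\<^bsub>M\<^esub>)"
    using M.finsum_singleton[OF assms(2,1), of "\<lambda>_. y"] by simp
  moreover have "(\<lambda>j. if i = j then y else \<zero>\<^bsub>M\<^esub>) \<in> Pi I N"
    using y submoduleD(2)[OF N] by auto
  ultimately show "y \<in> submodule_sum M I N"
    unfolding submodule_sum_def by blast
qed

lemma submodule_sum_least:
  assumes "submodule H R M" "\<And>i. i \<in> I \<Longrightarrow> N i \<subseteq> H"
  shows "submodule_sum M I N \<subseteq> H"
proof
  fix y
  assume "y \<in> submodule_sum M I N"
  then obtain x where "x \<in> Pi I N" and y: "y = (\<Oplus>\<^bsub>M\<^esub>i\<in>I. x i)"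
    unfolding submodule_sum_def by blast
  then have "x \<in> I \<rightarrow> H"
    using assms(2) by blast
  then show "y \<in> H"
    unfolding y by (rule submodule_finsum_closed[OF assms(1)])
qed

text \<open>Translates between the sum of the submodules \<open>R (a i)\<close>, used to define
  gcds, and explicit linear combinations; the coefficients are chosen one index at a time.\<close>

lemma in_submodule_sum_cyclic_iff:
  "g \<in> submodule_sum M I (\<lambda>i. cyclic_submodule R M (a i)) \<longleftrightarrow>
     (\<exists>s\<in>I \<rightarrow> carrier R. g = (\<Oplus>\<^bsub>M\<^esub>i\<in>I. s i \<odot>\<^bsub>M\<^esub> a i))"
  if a: "\<And>i. i \<in> I \<Longrightarrow> a i \<in> carrier M"
proof
  assume "g \<in> submodule_sum M I (\<lambda>i. cyclic_submodule R M (a i))"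
  then obtain x where x: "x \<in> Pi I (\<lambda>i. cyclic_submodule R M (a i))"
    and g: "g = (\<Oplus>\<^bsub>M\<^esub>i\<in>I. x i)"
    unfolding submodule_sum_def by blast
  then have "\<forall>i\<in>I. \<exists>r. r \<in> carrier R \<and> x i = r \<odot>\<^bsub>M\<^esub> a i"
    unfolding cyclic_submodule_def by blast
  then obtain s where s: "\<And>i. i \<in> I \<Longrightarrow> s i \<in> carrier R \<and> x i = s i \<odot>\<^bsub>M\<^esub> a i"
    by metis
  then have "g = (\<Oplus>\<^bsub>M\<^esub>i\<in>I. s i \<odot>\<^bsub>M\<^esub> a i)"
    unfolding g using a by (intro M.finsum_cong') (auto intro!: smult_closed)
  then show "\<exists>s\<in>I \<rightarrow> carrier R. g = (\<Oplus>\<^bsub>M\<^esub>i\<in>I. s i \<odot>\<^bsub>M\<^esub> a i)"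
    using s by blast
next
  assume "\<exists>s\<in>I \<rightarrow> carrier R. g = (\<Oplus>\<^bsub>M\<^esub>i\<in>I. s i \<odot>\<^bsub>M\<^esub> a i)"
  then show "g \<in> submodule_sum M I (\<lambda>i. cyclic_submodule R M (a i))"
    unfolding submodule_sum_def cyclic_submodule_def by blast
qed

section \<open>Submodules of Euclidean modules\<close>

text \<open>Dividing an element of \<open>H\<close> by a nonzero \<open>v\<close> in
  \<open>H\<close> of minimal value leaves a remainder in \<open>H\<close>. A nonzero remainder
  would have smaller value than \<open>v\<close>, so \<open>v\<close> generates
  \<open>H\<close>.\<close>

lemma euclidean_submodule_cyclic:
  assumes euclid: "euclidean_function R M P d" and H: "submodule H R M"
  obtains h where "h \<in> carrier M" "H = cyclic_submodule R M h"
\<comment> \<open>The zero submodule has no nonzero element to minimize over; its generator is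
  zero.\<close>
proof (cases "H = {\<zero>\<^bsub>M\<^esub>}")
  case True
  have "cyclic_submodule R M \<zero>\<^bsub>M\<^esub> = {\<zero>\<^bsub>M\<^esub>}"
    by (auto simp: cyclic_submodule_def smult_r_null intro!: exI[of _ "\<one>\<^bsub>R\<^esub>"])
  then show ?thesis
    using that[of "\<zero>\<^bsub>M\<^esub>"] True by simp
next
  case False
  let ?C = "carrier M - {\<zero>\<^bsub>M\<^esub>}"
  have art: "artinian_poset (P\<lparr>carrier := d ` ?C\<rparr>)"
    and div: "\<And>u v. \<lbrakk>u \<in> ?C; v \<in> ?C\<rbrakk> \<Longrightarrow> \<exists>q \<in> carrier R. \<exists>r \<in> carrier M.
      u = q \<odot>\<^bsub>M\<^esub> v \<oplus>\<^bsub>M\<^esub> r \<and> (r = \<zero>\<^bsub>M\<^esub> \<or> d r \<sqsubset>\<^bsub>P\<^esub> d v)"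
    using euclid by (simp_all only: euclidean_function_def)
  \<comment> \<open>The Artinian condition concerns the image of \<open>d\<close>, so a minimal
    value is sought first, and then an element attaining it.\<close>
  have "d ` (H - {\<zero>\<^bsub>M\<^esub>}) \<subseteq> carrier (P\<lparr>carrier := d ` ?C\<rparr>)"
    using submoduleD(1)[OF H] by auto
  moreover have "d ` (H - {\<zero>\<^bsub>M\<^esub>}) \<noteq> {}"
    using False submoduleD(2)[OF H] by auto
  ultimately obtain m where "m \<in> d ` (H - {\<zero>\<^bsub>M\<^esub>})"
    and "\<And>x. x \<in> d ` (H - {\<zero>\<^bsub>M\<^esub>}) \<Longrightarrow> \<not> x \<sqsubset>\<^bsub>P\<lparr>carrier := d ` ?C\<rparr>\<^esub> m"
    using artinian_poset_minimal[OF art] by metis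
  then obtain v where v: "v \<in> H" "v \<noteq> \<zero>\<^bsub>M\<^esub>"
    and min: "\<And>w. \<lbrakk>w \<in> H; w \<noteq> \<zero>\<^bsub>M\<^esub>\<rbrakk> \<Longrightarrow> \<not> d w \<sqsubset>\<^bsub>P\<^esub> d v"
    \<comment> \<open>Changing the carrier leaves the order relation itself untouched, so minimality
      in the image is minimality with respect to the order of \<open>P\<close>.\<close>
    by (auto simp: lless_def)
  have vM: "v \<in> carrier M"
    using v submoduleD(1)[OF H] by blast
  have "u \<in> cyclic_submodule R M v" if u: "u \<in> H" for u
  \<comment> \<open>Division with remainder is provided only for nonzero dividends.\<close>
  proof (cases "u = \<zero>\<^bsub>M\<^esub>")
    case True
    then show ?thesis
      using submoduleD(2)[OF cyclic_submodule_submodule[OF vM]] by simp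
  next
    case False
    have uM: "u \<in> carrier M"
      using u submoduleD(1)[OF H] by blast
    then obtain q r where q: "q \<in> carrier R" and r: "r \<in> carrier M"
      and eq: "u = q \<odot>\<^bsub>M\<^esub> v \<oplus>\<^bsub>M\<^esub> r"
      and small: "r = \<zero>\<^bsub>M\<^esub> \<or> d r \<sqsubset>\<^bsub>P\<^esub> d v"
      using div[of u v] False v(2) vM by blast
    \<comment> \<open>Solving for the remainder exhibits it as a combination of \<open>v\<close> and
      \<open>u\<close>, both in \<open>H\<close>.\<close>
    have "r = (\<ominus>\<^bsub>R\<^esub> q) \<odot>\<^bsub>M\<^esub> v \<oplus>\<^bsub>M\<^esub> u"
      using q r vM unfolding eq by (simp add: smult_l_minus smult_closed M.r_neg1)
    then have "r \<in> H"
      using submoduleD(3,4)[OF H] q u v(1) by simp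
    then have "r = \<zero>\<^bsub>M\<^esub>"
      using min small by blast
    then show ?thesis
      using eq q vM by (auto simp: cyclic_submodule_def smult_closed)
  qed
  then have "H = cyclic_submodule R M v"
    using cyclic_submodule_least[OF H v(1)] by blast
  then show ?thesis
    using that vM by blast
qed

end

section \<open>Characterizations of greatest common divisors\<close>

theorem proposition2p12:
  fixes R :: "('a, 'k) ring_scheme"
    and M :: "('a, 'b, 'l) module_scheme"
    and n :: nat and a :: "nat \<Rightarrow> 'b" and g :: 'b
  assumes "ring R"
    and "euclidean_module TYPE('p) R M"
    and "\<forall>i\<in>{1..n}. a i \<in> carrier M"
    and "g \<in> carrier M"
  shows "(is_gcd R M n a g \<longleftrightarrow>
           (\<forall>i\<in>{1..n}. \<exists>r\<in>carrier R. a i = r \<odot>\<^bsub>M\<^esub> g) \<and>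
           (\<forall>g'\<in>carrier M. (\<forall>i\<in>{1..n}. \<exists>r'\<in>carrier R. a i = r' \<odot>\<^bsub>M\<^esub> g') \<longrightarrow>
              (\<exists>\<alpha>\<in>carrier R. g = \<alpha> \<odot>\<^bsub>M\<^esub> g')))
       \<and> (is_gcd R M n a g \<longleftrightarrow>
           (\<forall>i\<in>{1..n}. \<exists>r\<in>carrier R. a i = r \<odot>\<^bsub>M\<^esub> g) \<and>
           (\<exists>s\<in>{1..n} \<rightarrow> carrier R. g = (\<Oplus>\<^bsub>M\<^esub>i\<in>{1..n}. s i \<odot>\<^bsub>M\<^esub> a i)))
       \<and> (\<exists>h. is_gcd R M n a h)
       \<and> (\<forall>h. is_gcd R M n a h \<longrightarrow>
           (\<exists>s\<in>{1..n} \<rightarrow> carrier R. h = (\<Oplus>\<^bsub>M\<^esub>i\<in>{1..n}. s i \<odot>\<^bsub>M\<^esub> a i)))"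
proof -
  interpret left_module R M
    using assms(2) by (simp add: euclidean_module_def)
  define N where "N = submodule_sum M {1..n} (\<lambda>i. cyclic_submodule R M (a i))"
  let ?comb = "\<lambda>x. \<exists>s\<in>{1..n} \<rightarrow> carrier R. x = (\<Oplus>\<^bsub>M\<^esub>i\<in>{1..n}. s i \<odot>\<^bsub>M\<^esub> a i)"
  let ?div = "\<lambda>x. \<forall>i\<in>{1..n}. \<exists>r\<in>carrier R. a i = r \<odot>\<^bsub>M\<^esub> x"
  have aM: "a i \<in> carrier M" if "i \<in> {1..n}" for i
    using assms(3) that by blast
  have N: "submodule N R M"
    unfolding N_def using aM by (intro submodule_sum_submodule cyclic_submodule_submodule)
  have gcd_iff: "is_gcd R M n a x \<longleftrightarrow> x \<in> carrier M \<and> cyclic_submodule R M x = N" for x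
    by (simp add: is_gcd_def N_def)
  have comb_iff: "?comb x \<longleftrightarrow> x \<in> N" for x
    unfolding N_def using in_submodule_sum_cyclic_iff[of "{1..n}" a] aM by blast
  have aN: "a i \<in> N" if "i \<in> {1..n}" for i
    using submodule_sum_upper[of "{1..n}" i "\<lambda>i. cyclic_submodule R M (a i)"]
      cyclic_submodule_submodule generator_in_cyclic_submodule aM that
    unfolding N_def by blast
  \<comment> \<open>Common divisors become upper bounds of \<open>N\<close> among cyclic submodules,
    because \<open>N\<close> is the least submodule containing all \<open>a i\<close>.\<close>
  have div_iff: "?div x \<longleftrightarrow> N \<subseteq> cyclic_submodule R M x" if x: "x \<in> carrier M" for x
  proof
    assume "?div x"
    then have "a i \<in> cyclic_submodule R M x" if "i \<in> {1..n}" for i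
      using that unfolding cyclic_submodule_def by blast
    then show "N \<subseteq> cyclic_submodule R M x"
      unfolding N_def using cyclic_submodule_submodule[OF x]
      by (intro submodule_sum_least cyclic_submodule_least)
  next
    assume "N \<subseteq> cyclic_submodule R M x"
    then show "?div x"
      using aN unfolding cyclic_submodule_def by blast
  qed
  have mem_iff: "x \<in> N \<longleftrightarrow> cyclic_submodule R M x \<subseteq> N" if "x \<in> carrier M" for x
    using cyclic_submodule_least[OF N] generator_in_cyclic_submodule[OF that] by blast
  have mult_iff: "(\<exists>r\<in>carrier R. x = r \<odot>\<^bsub>M\<^esub> y) \<longleftrightarrow> x \<in> cyclic_submodule R M y" for x y
    unfolding cyclic_submodule_def by blast
  obtain h where h: "h \<in> carrier M" "N = cyclic_submodule R M h"
    using assms(2) euclidean_submodule_cyclic N unfolding euclidean_module_def by metis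
  \<comment> \<open>The equality defining a gcd splits into two inclusions: \<open>?div\<close> is
    one and \<open>?comb\<close> is the other.\<close>
  have gcd_comb: "is_gcd R M n a x \<longleftrightarrow> ?div x \<and> ?comb x" if "x \<in> carrier M" for x
    using that unfolding comb_iff div_iff[OF that] mem_iff[OF that] gcd_iff by blast
  have gcd_least: "is_gcd R M n a g \<longleftrightarrow> ?div g \<and>
      (\<forall>g'\<in>carrier M. ?div g' \<longrightarrow> (\<exists>\<alpha>\<in>carrier R. g = \<alpha> \<odot>\<^bsub>M\<^esub> g'))" (is "_ \<longleftrightarrow> _ \<and> ?least")
  proof -
    \<comment> \<open>Statements (2) and (3) share the divisibility clause, so it suffices to
      compare their second clauses.\<close>
    have "?least \<longleftrightarrow> g \<in> N"
    proof
      assume ?least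
      then show "g \<in> N"
        \<comment> \<open>The generator \<open>h\<close> of \<open>N\<close> is itself a common
          divisor, so \<open>?least\<close> applied to it puts \<open>g\<close> into
          \<open>R h = N\<close>.\<close>
        using h div_iff[OF h(1)] mult_iff[of g h] by blast
    next
      assume "g \<in> N"
      then show ?least
        \<comment> \<open>Conversely, every common divisor \<open>g'\<close> satisfies
          \<open>N \<subseteq> R g'\<close>, so \<open>g\<close> is a multiple of it.\<close>
        using div_iff mult_iff by blast
    qed
    then show ?thesis
      using gcd_comb[OF assms(4)] unfolding comb_iff by blast
  qed
  \<comment> \<open>Existence gives content to the final claim that every gcd is a linear
    combination.\<close>
  have "\<exists>h. is_gcd R M n a h"
    using h gcd_iff by blast
  moreover have "\<forall>x. is_gcd R M n a x \<longrightarrow> ?comb x"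
    using gcd_comb gcd_iff by blast
  ultimately show ?thesis
    using gcd_least gcd_comb[OF assms(4)] by blast
qed

end
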